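(* Let $F\colon\mathbb Z_p^{n}\to\mathbb Z_p^{n}$ be uniformly differentiable modulo $p$ on $\mathbb Z_p^n$ with integer-valued partial derivatives modulo $p$. Then $F$ is asymptotically measure-preserving if and only if $F$ is bijective modulo $p^{N_1(F)}$ and $\det F'_1(\mathbf u)\not\equiv 0\pmod p$ for every $\mathbf u\in\{0,1,\dots,p^{N_1(F)}-1\}^n$. Equivalently, $F$ is asymptotically measure-preserving if and only if $F$ is bijective modulo $p^{N_1(F)+1}$.
   Context: $\mathbb Z_p$, $\mathbb Q_p$, $\|\cdot\|_p$ are the $p$-adic integers, numbers and norm; for vectors $\|(u_1,\dots,u_n)\|_p=\max_i\|u_i\|_p$, and $\mathbf a\equiv\mathbf b\pmod{p^s}$ means $\|\mathbf a-\mathbf b\|_p\le p^{-s}$. $F\colon\mathbb Z_p^n\to\mathbb Z_p^n$ is uniformly differentiable modulo $p^k$ on $\mathbb Z_p^n$ if there exist $N\in\mathbb N$ and for every $\mathbf u$ an $n\times n$ matrix $F'_k(\mathbf u)$ over $\mathbb Q_p$ (Jacobi matrix modulo $p^k$) such that for every integer $K\ge N$, every $\mathbf u\in\mathbb Z_p^n$ and every row vector $\mathbf h\in\mathbb Z_p^n$ with $\|\mathbf h\|_p\le p^{-K}$: $F(\mathbf u+\mathbf h)\equiv F(\mathbf u)+\mathbf hF'_k(\mathbf u)\pmod{p^{k+K}}$. The least such $N$ is $N_k(F)$. Integer-valued partial derivatives modulo $p^k$ means $F'_k(\mathbf u)$ can be chosen with entries in $\mathbb Z_p$ for every $\mathbf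 u$; $\det F'_1(\mathbf u)$ is the Jacobian modulo $p$. $F$ is bijective modulo $p^k$ if the map $\{0,\dots,p^k-1\}^n\to(\mathbb Z/p^k)^n$, $\mathbf x\mapsto F(\mathbf x)\bmod p^k$, is a bijection; $F$ is asymptotically measure-preserving if it is bijective modulo $p^k$ for all sufficiently large $k$. *)

theory Defs
  imports
    "HOL-Analysis.Analysis"
    "HOL-Computational_Algebra.Polynomial_Factorial"
    "Berlekamp_Zassenhaus.Finite_Field"
begin

section \<open>The ring of p-adic integers\<close>

text \<open>
  The prime $p$ is the cardinality of the index type, \<open>p = CARD('p)\<close> with \<open>'p :: prime_card\<close>.
  The ring of $p$-adic integers is the inverse limit of the rings $\mathbf{Z}/p^k$: an element is a
  compatible family of residues, the \<open>k\<close>-th one being represented in \<open>{0..<p ^ k}\<close>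
  (these bounds follow from the compatibility condition).
\<close>

typedef (overloaded) 'p padic_int =
  "{x :: nat \<Rightarrow> int. \<forall>k. x (Suc k) mod int CARD('p :: prime_card) ^ k = x k}"
  morphisms residue Abs_padic_int
  by (rule exI[of _ "\<lambda>_. 0"]) simp

setup_lifting type_definition_padic_int

lemma mod_Suc_power_mod: "(a mod p ^ Suc k) mod p ^ k = a mod p ^ k" for a p :: int
  by (rule mod_mod_cancel) simp

lemma residue_mod_Suc:
  "residue (x :: 'p :: prime_card padic_int) (Suc k) mod int CARD('p) ^ k = residue x k"
  using residue[of x] by simp

lemma residue_mod:
  assumes "k \<le> m"
  shows "residue (x :: 'p :: prime_card padic_int) m mod int CARD('p) ^ k = residue x k"
  using assms
proof (induction m rule: dec_induct)
  case base
  show ?case using residue_mod_Suc[of x k]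
    by (metis mod_mod_trivial)
next
  case (step m)
  have "residue x (Suc m) mod int CARD('p) ^ k
      = (residue x (Suc m) mod int CARD('p) ^ m) mod int CARD('p) ^ k"
    by (rule mod_mod_cancel[symmetric]) (use step.hyps in \<open>simp add: le_imp_power_dvd\<close>)
  with step.IH show ?case by (simp add: residue_mod_Suc)
qed

lemma residue_mod_self [simp]:
  "residue (x :: 'p :: prime_card padic_int) k mod int CARD('p) ^ k = residue x k"
  by (rule residue_mod) simp

instantiation padic_int :: (prime_card) comm_ring_1
begin

lift_definition zero_padic_int :: "'a padic_int" is "\<lambda>_. 0" by simp

lift_definition one_padic_int :: "'a padic_int" is "\<lambda>k. 1 mod int CARD('a) ^ k"
  by (simp only: mod_Suc_power_mod)

lift_definition plus_padic_int :: "'a padic_int \<Rightarrow> 'a padic_int \<Rightarrow> 'a padic_int"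
  is "\<lambda>x y k. (x k + y k) mod int CARD('a) ^ k"
  by (simp only: mod_Suc_power_mod) (metis mod_add_eq)

lift_definition minus_padic_int :: "'a padic_int \<Rightarrow> 'a padic_int \<Rightarrow> 'a padic_int"
  is "\<lambda>x y k. (x k - y k) mod int CARD('a) ^ k"
  by (simp only: mod_Suc_power_mod) (metis mod_diff_eq)

lift_definition uminus_padic_int :: "'a padic_int \<Rightarrow> 'a padic_int"
  is "\<lambda>x k. (- x k) mod int CARD('a) ^ k"
  by (simp only: mod_Suc_power_mod) (metis mod_minus_eq)

lift_definition times_padic_int :: "'a padic_int \<Rightarrow> 'a padic_int \<Rightarrow> 'a padic_int"
  is "\<lambda>x y k. (x k * y k) mod int CARD('a) ^ k"
  by (simp only: mod_Suc_power_mod) (metis mod_mult_eq)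

instance
proof
  fix a b c :: "'a padic_int"
  note [simp] = zero_padic_int.rep_eq one_padic_int.rep_eq plus_padic_int.rep_eq
    minus_padic_int.rep_eq uminus_padic_int.rep_eq times_padic_int.rep_eq
  show "a * b * c = a * (b * c)"
    by (rule residue_inject[THEN iffD1]) (simp add: fun_eq_iff mod_simps mult.assoc)
  show "a * b = b * a"
    by (rule residue_inject[THEN iffD1]) (simp add: fun_eq_iff mult.commute)
  show "1 * a = a"
    by (rule residue_inject[THEN iffD1]) (simp add: fun_eq_iff mod_simps)
  show "a + b + c = a + (b + c)"
    by (rule residue_inject[THEN iffD1]) (simp add: fun_eq_iff mod_simps add.assoc)
  show "a + b = b + a"
    by (rule residue_inject[THEN iffD1]) (simp add: fun_eq_iff add.commute)
  show "0 + a = a"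
    by (rule residue_inject[THEN iffD1]) (simp add: fun_eq_iff)
  show "- a + a = 0"
    by (rule residue_inject[THEN iffD1]) (simp add: fun_eq_iff mod_simps)
  show "a - b = a + - b"
    by (rule residue_inject[THEN iffD1]) (simp add: fun_eq_iff mod_simps)
  show "(a + b) * c = a * c + b * c"
    by (rule residue_inject[THEN iffD1]) (simp add: fun_eq_iff mod_simps distrib_right)
  have "1 mod int CARD('a) ^ 1 = 1"
    using prime_gt_1_nat[OF prime_card[where 'a = 'a]] by simp
  then show "(0 :: 'a padic_int) \<noteq> 1"
    by (metis one_padic_int.rep_eq zero_padic_int.rep_eq zero_neq_one)
qed

end

text \<open>The $p$-adic valuation, meaningful for nonzero arguments only.\<close>

definition padic_val :: "'p :: prime_card padic_int \<Rightarrow> nat" where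
  "padic_val x = (LEAST k. residue x (Suc k) \<noteq> 0)"

lemma residue_0_right [simp]: "residue (x :: 'p :: prime_card padic_int) 0 = 0"
  using residue_mod_self[of x 0] by simp

lemma padic_val_residue:
  fixes x :: "'p :: prime_card padic_int"
  assumes "x \<noteq> 0"
  shows "residue x (padic_val x) = 0" "residue x (Suc (padic_val x)) \<noteq> 0"
proof -
  obtain m where "residue x m \<noteq> 0"
    using assms by (metis residue_inject zero_padic_int.rep_eq ext)
  then obtain k where "residue x (Suc k) \<noteq> 0"
    by (cases m) auto
  then show "residue x (Suc (padic_val x)) \<noteq> 0"
    unfolding padic_val_def by (rule LeastI)
  show "residue x (padic_val x) = 0"
  proof (cases "padic_val x")
    case (Suc k)
    then show ?thesis
      using not_less_Least[of k "\<lambda>k. residue x (Suc k) \<noteq> 0"] by (auto simp: padic_val_def)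
  qed simp
qed

lemma padic_val_eqI:
  fixes x :: "'p :: prime_card padic_int"
  assumes "residue x v = 0" "residue x (Suc v) \<noteq> 0"
  shows "padic_val x = v"
  unfolding padic_val_def
proof (rule Least_equality)
  fix k assume k: "residue x (Suc k) \<noteq> 0"
  show "v \<le> k"
  proof (rule ccontr)
    assume "\<not> v \<le> k"
    then have "residue x (Suc k) = residue x v mod int CARD('p) ^ Suc k"
      by (simp add: residue_mod del: power_Suc)
    with assms(1) k show False by simp
  qed
qed (fact assms(2))

lemma padic_val_mult:
  fixes x y :: "'p :: prime_card padic_int"
  assumes "x \<noteq> 0" "y \<noteq> 0"
  shows "x * y \<noteq> 0" "padic_val (x * y) = padic_val x + padic_val y"
proof -
  define p a b where "p = int CARD('p)" and "a = padic_val x" and "b = padic_val y"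
  define M where "M = Suc (a + b)"
  have p: "prime p" by (simp add: p_def prime_card)
  have dvd: "p ^ k dvd residue z M \<longleftrightarrow> residue z k = 0" if "k \<le> M" for k and z :: "'p padic_int"
    using residue_mod[OF that, of z] by (simp add: p_def dvd_eq_mod_eq_0)
  have mx: "multiplicity p (residue x M) = a"
    by (rule multiplicity_eqI; subst dvd)
      (use padic_val_residue[OF assms(1)] in \<open>simp_all add: a_def M_def\<close>)
  have my: "multiplicity p (residue y M) = b"
    by (rule multiplicity_eqI; subst dvd)
      (use padic_val_residue[OF assms(2)] in \<open>simp_all add: b_def M_def\<close>)
  have nz: "residue x M \<noteq> 0" "residue y M \<noteq> 0"
    using dvd[of "Suc a" x] dvd[of "Suc b" y] padic_val_residue(2)[OF assms(1)]
      padic_val_residue(2)[OF assms(2)] by (auto simp: a_def b_def M_def)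
  have mult: "multiplicity p (residue x M * residue y M) = a + b"
    using prime_elem_multiplicity_mult_distrib[OF prime_imp_prime_elem[OF p] nz] mx my by simp
  have res: "residue (x * y) k = (residue x M * residue y M) mod p ^ k" if "k \<le> M" for k
    using residue_mod[OF that, of x] residue_mod[OF that, of y]
    by (metis times_padic_int.rep_eq mod_mult_eq p_def)
  have dvd': "p ^ k dvd residue x M * residue y M \<longleftrightarrow> k \<le> a + b" for k
    using p nz mult by (metis power_dvd_iff_le_multiplicity mult_eq_0_iff not_prime_unit)
  have 1: "residue (x * y) (a + b) = 0"
    using dvd'[of "a + b"] by (simp add: res M_def)
  have 2: "residue (x * y) (Suc (a + b)) \<noteq> 0"
    using dvd'[of "Suc (a + b)"] res[of "Suc (a + b)"] by (auto simp: M_def dvd_eq_mod_eq_0)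
  from 2 show "x * y \<noteq> 0" by (metis zero_padic_int.rep_eq)
  from 1 2 show "padic_val (x * y) = padic_val x + padic_val y"
    unfolding a_def b_def by (rule padic_val_eqI)
qed

instance padic_int :: (prime_card) idom
  by standard (rule padic_val_mult(1))

section \<open>The field of p-adic numbers and the p-adic norm\<close>

type_synonym 'p padic = "'p padic_int fract"

definition padic_int_norm :: "'p :: prime_card padic_int \<Rightarrow> real" where
  "padic_int_norm x = (if x = 0 then 0 else 1 / real CARD('p) ^ padic_val x)"

lemma padic_int_norm_mult: "padic_int_norm (x * y) = padic_int_norm x * padic_int_norm y"
  by (simp add: padic_int_norm_def padic_val_mult power_add)

lemma padic_int_norm_eq_0_iff [simp]:
  "padic_int_norm (x :: 'p :: prime_card padic_int) = 0 \<longleftrightarrow> x = 0"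
  using prime_gt_0_nat[OF prime_card[where 'a = 'p]] by (simp add: padic_int_norm_def)

definition padic_norm :: "'p :: prime_card padic \<Rightarrow> real" where
  "padic_norm q =
    (THE r. \<exists>a b. b \<noteq> 0 \<and> q = Fract a b \<and> r = padic_int_norm a / padic_int_norm b)"

lemma padic_norm_Fract:
  assumes "b \<noteq> 0"
  shows "padic_norm (Fract a b) = padic_int_norm a / padic_int_norm b"
  unfolding padic_norm_def
proof (rule the_equality)
  fix r assume "\<exists>c d. d \<noteq> 0 \<and> Fract a b = Fract c d \<and> r = padic_int_norm c / padic_int_norm d"
  then obtain c d where d: "d \<noteq> 0" "a * d = c * b" and r: "r = padic_int_norm c / padic_int_norm d"
    using assms by (auto simp: eq_fract)
  have "padic_int_norm a * padic_int_norm d = padic_int_norm c * padic_int_norm b"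
    using d(2) by (metis padic_int_norm_mult)
  with assms d(1) show "r = padic_int_norm a / padic_int_norm b"
    by (simp add: r frac_eq_eq)
qed (use assms in blast)

section \<open>Vectors of p-adic numbers\<close>

definition vec_of_padic_int :: "'p :: prime_card padic_int ^ 'n \<Rightarrow> 'p padic ^ 'n" where
  "vec_of_padic_int u = (\<chi> i. to_fract (u $ i))"

definition padic_vec_norm :: "'p :: prime_card padic ^ 'n \<Rightarrow> real" where
  "padic_vec_norm u = Max (range (\<lambda>i. padic_norm (u $ i)))"

definition padic_vec_cong :: "nat \<Rightarrow> 'p :: prime_card padic ^ 'n \<Rightarrow> 'p padic ^ 'n \<Rightarrow> bool" where
  "padic_vec_cong s a b \<longleftrightarrow> padic_vec_norm (a - b) \<le> 1 / real CARD('p) ^ s"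

definition padic_cong :: "nat \<Rightarrow> 'p :: prime_card padic \<Rightarrow> 'p padic \<Rightarrow> bool" where
  "padic_cong s a b \<longleftrightarrow> padic_norm (a - b) \<le> 1 / real CARD('p) ^ s"

section \<open>Uniform differentiability modulo a power of p\<close>

text \<open>
  \<open>jacobi_mod_from k N F J\<close>: the matrices \<open>J u\<close> satisfy the approximation property
  modulo $p^{k+K}$ for all $K \ge N$.
\<close>

definition jacobi_mod_from ::
  "nat \<Rightarrow> nat \<Rightarrow> ('p :: prime_card padic_int ^ 'n \<Rightarrow> 'p padic_int ^ 'n)
    \<Rightarrow> ('p padic_int ^ 'n \<Rightarrow> 'p padic ^ 'n ^ 'n) \<Rightarrow> bool" where
  "jacobi_mod_from k N F J \<longleftrightarrow>
    (\<forall>K\<ge>N. \<forall>u h. padic_vec_norm (vec_of_padic_int h) \<le> 1 / real CARD('p) ^ K \<longrightarrow>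
      padic_vec_cong (k + K) (vec_of_padic_int (F (u + h)))
        (vec_of_padic_int (F u) + vec_of_padic_int h v* J u))"

definition jacobi_mod ::
  "nat \<Rightarrow> ('p :: prime_card padic_int ^ 'n \<Rightarrow> 'p padic_int ^ 'n)
    \<Rightarrow> ('p padic_int ^ 'n \<Rightarrow> 'p padic ^ 'n ^ 'n) \<Rightarrow> bool" where
  "jacobi_mod k F J \<longleftrightarrow> (\<exists>N. jacobi_mod_from k N F J)"

definition uniformly_differentiable_mod ::
  "nat \<Rightarrow> ('p :: prime_card padic_int ^ 'n \<Rightarrow> 'p padic_int ^ 'n) \<Rightarrow> bool" where
  "uniformly_differentiable_mod k F \<longleftrightarrow> (\<exists>N J. jacobi_mod_from k N F J)"

text \<open>The number $N_k(F)$.\<close>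

definition least_N ::
  "nat \<Rightarrow> ('p :: prime_card padic_int ^ 'n \<Rightarrow> 'p padic_int ^ 'n) \<Rightarrow> nat" where
  "least_N k F = (LEAST N. \<exists>J. jacobi_mod_from k N F J)"

definition integer_valued_derivatives_mod ::
  "nat \<Rightarrow> ('p :: prime_card padic_int ^ 'n \<Rightarrow> 'p padic_int ^ 'n) \<Rightarrow> bool" where
  "integer_valued_derivatives_mod k F \<longleftrightarrow>
    (\<exists>J. jacobi_mod k F J \<and> (\<forall>u i j. J u $ i $ j \<in> range to_fract))"

section \<open>Bijectivity modulo a power of p\<close>

text \<open>
  The box \<open>{0, \<dots>, p ^ k - 1}\<^sup>n\<close>; it serves both as a set of integer vectors and as the
  set of canonical representatives of $(\mathbf{Z}/p^k)^n$.  Since \<open>residue x k\<close> is the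
  representative of \<open>x mod p ^ k\<close> in \<open>{0..<p ^ k}\<close>, the map below is reduction modulo $p^k$.
\<close>

definition residue_box :: "'p :: prime_card itself \<Rightarrow> nat \<Rightarrow> (int ^ 'n) set" where
  "residue_box _ k = {x. \<forall>i. x $ i \<in> {0..<int CARD('p) ^ k}}"

definition padic_vec_of_int :: "int ^ 'n \<Rightarrow> 'p :: prime_card padic_int ^ 'n" where
  "padic_vec_of_int x = (\<chi> i. of_int (x $ i))"

definition vec_residue :: "nat \<Rightarrow> 'p :: prime_card padic_int ^ 'n \<Rightarrow> int ^ 'n" where
  "vec_residue k u = (\<chi> i. residue (u $ i) k)"

definition bijective_mod ::
  "nat \<Rightarrow> ('p :: prime_card padic_int ^ 'n \<Rightarrow> 'p padic_int ^ 'n) \<Rightarrow> bool" where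
  "bijective_mod k F \<longleftrightarrow>
    bij_betw (\<lambda>x. vec_residue k (F (padic_vec_of_int x)))
      (residue_box TYPE('p) k) (residue_box TYPE('p) k)"

definition asymptotically_measure_preserving ::
  "('p :: prime_card padic_int ^ 'n \<Rightarrow> 'p padic_int ^ 'n) \<Rightarrow> bool" where
  "asymptotically_measure_preserving F \<longleftrightarrow> (\<forall>\<^sub>F k in sequentially. bijective_mod k F)"

end

theory Submission
  imports Defs
begin

text \<open>
  Two Jacobi matrices modulo $p$ at the same point agree modulo $p$, as one sees by taking
  $\mathbf h = p^K \mathbf e_i$.  Hence every Jacobi matrix is integral as soon as one is, it has the
  approximation property from $N = N_1(F)$ on, and it is periodic modulo $p$ with period $p^N$.
  For $k \ge N$ the congruence
  $F(\mathbf u + p^k \mathbf w) \equiv F(\mathbf u) + p^k \mathbf w F'_1(\mathbf u)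
  \pmod{p^{k+1}}$ shows that $F$ is well defined modulo $p^k$ and acts on the fibre of
  $(\mathbf{Z}/p^{k+1})^n \to (\mathbf{Z}/p^k)^n$ over $\mathbf u$ as the linear map
  $\mathbf w \mapsto \mathbf w F'_1(\mathbf u)$ over the field with $p$ elements.  So $F$ is
  bijective modulo $p^{k+1}$ iff it is bijective modulo $p^k$ and all these maps are invertible,
  a condition independent of $k$.
\<close>

section \<open>Divisibility and norm of p-adic integers\<close>

text \<open>The prime p inside the ring: residues and norms are all restated as divisibility by
  powers of it.\<close>

definition uniformizer :: "'p :: prime_card padic_int" where
  "uniformizer = of_nat CARD('p)"

lemma residue_of_nat:
  "residue (of_nat m :: 'p :: prime_card padic_int) k = int m mod int CARD('p) ^ k"
  by (induction m) (simp_all add: zero_padic_int.rep_eq one_padic_int.rep_eq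
      plus_padic_int.rep_eq mod_simps)

lemma residue_of_int:
  "residue (of_int m :: 'p :: prime_card padic_int) k = m mod int CARD('p) ^ k"
proof (cases m)
  case (nonneg n)
  then show ?thesis by (simp add: residue_of_nat)
next
  case (neg n)
  then show ?thesis
    by (simp add: residue_of_nat uminus_padic_int.rep_eq plus_padic_int.rep_eq
        one_padic_int.rep_eq minus_padic_int.rep_eq mod_simps del: of_nat_Suc)
qed

lemma uniformizer_power:
  "(uniformizer :: 'p :: prime_card padic_int) ^ k = of_nat (CARD('p) ^ k)"
  by (simp add: uniformizer_def)

lemma uniformizer_nonzero [simp]: "(uniformizer :: 'p :: prime_card padic_int) \<noteq> 0"
proof
  assume "(uniformizer :: 'p padic_int) = 0"
  \<comment> \<open>Level 2 is the first that detects p, since p is 0 modulo p but not modulo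
    p^2.\<close>
  then have "residue (uniformizer :: 'p padic_int) 2 = 0"
    by (simp add: zero_padic_int.rep_eq)
  moreover have "int CARD('p) > 1"
    using prime_gt_1_nat[OF prime_card[where 'a = 'p]] by simp
  ultimately show False
    by (simp add: uniformizer_def residue_of_nat power2_eq_square)
qed

lemma residue_uniformizer_power_mult:
  fixes y :: "'p :: prime_card padic_int"
  shows "residue (uniformizer ^ k * y) m = (int CARD('p) ^ k * residue y m) mod int CARD('p) ^ m"
  unfolding uniformizer_power times_padic_int.rep_eq residue_of_nat by (simp add: mod_simps)

text \<open>The nontrivial direction constructs x / p^k level by level and checks that the levels
  form a compatible family.\<close>

lemma residue_eq_0_iff:
  fixes x :: "'p :: prime_card padic_int"
  shows "residue x k = 0 \<longleftrightarrow> uniformizer ^ k dvd x"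
proof
  assume "uniformizer ^ k dvd x"
  then show "residue x k = 0"
    by (auto simp: dvd_def residue_uniformizer_power_mult)
next
  assume 0: "residue x k = 0"
  define p where "p = int CARD('p)"
  have p: "p > 0"
    using prime_gt_0_nat[OF prime_card[where 'a = 'p]] by (simp add: p_def)
  \<comment> \<open>Division by p^k costs k digits of precision, so level \<open>m\<close> of the
    quotient is read off level \<open>m + k\<close> of \<open>x\<close>.\<close>
  define y where "y m = residue x (m + k) div p ^ k" for m
  have dvd: "p ^ k dvd residue x (m + k)" for m
    using residue_mod[of k "m + k" x] 0 by (simp add: p_def dvd_eq_mod_eq_0)
  have y: "p ^ k * y m = residue x (m + k)" for m
    using dvd[of m] by (simp add: y_def)
  have "y (Suc m) mod p ^ m = y m" for m
  proof -
    have "p ^ k * (y (Suc m) mod p ^ m) = p ^ k * y (Suc m) mod (p ^ (m + k))"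
      unfolding mult_mod_right power_add by (simp only: mult.commute)
    also have "\<dots> = p ^ k * y m"
      unfolding y using residue_mod_Suc[of x "m + k"] by (simp add: p_def)
    finally show ?thesis using p by simp
  qed
  then have res: "residue (Abs_padic_int y :: 'p padic_int) = y"
    by (intro Abs_padic_int_inverse) (simp add: p_def)
  have "x = uniformizer ^ k * Abs_padic_int y"
  proof (rule residue_inject[THEN iffD1], rule ext)
    fix m
    have "residue (uniformizer ^ k * Abs_padic_int y :: 'p padic_int) m
        = (p ^ k * y m) mod p ^ m"
      by (simp add: residue_uniformizer_power_mult res p_def)
    also have "\<dots> = residue x m"
      unfolding y using residue_mod[of m "m + k" x] by (simp add: p_def)
    finally show "residue x m = residue (uniformizer ^ k * Abs_padic_int y :: 'p padic_int) m"
      by simp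
  qed
  then show "uniformizer ^ k dvd x" by simp
qed

lemma residue_eq_iff:
  fixes x y :: "'p :: prime_card padic_int"
  shows "residue x k = residue y k \<longleftrightarrow> uniformizer ^ k dvd x - y"
proof -
  have "residue (x - y) k = 0 \<longleftrightarrow>
      residue x k mod int CARD('p) ^ k = residue y k mod int CARD('p) ^ k"
    by (simp add: minus_padic_int.rep_eq mod_eq_dvd_iff dvd_eq_mod_eq_0
        del: residue_mod_self)
  then show ?thesis by (simp add: residue_eq_0_iff)
qed

text \<open>The ring is local: outside the ideal generated by p, each residue is invertible modulo
  p^k, and uniqueness of inverses makes the chosen ones compatible.\<close>

lemma padic_int_unit:
  fixes x :: "'p :: prime_card padic_int"
  assumes "\<not> uniformizer dvd x"
  shows "x dvd 1"
proof -
  define p where "p = int CARD('p)"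
  have p: "prime p" by (simp add: p_def prime_card)
  have cop: "coprime (residue x k) (p ^ k)" for k
  proof (cases k)
    case (Suc l)
    have "residue x k mod p ^ 1 \<noteq> 0"
      using assms residue_eq_0_iff[of x 1] residue_mod[of 1 k x] Suc by (simp add: p_def)
    then have "\<not> p dvd residue x k" by (simp add: dvd_eq_mod_eq_0)
    then show ?thesis
      using p by (metis coprime_commute coprime_power_right_iff prime_imp_coprime)
  qed simp
  have "\<exists>z. residue x k * z mod p ^ k = 1 mod p ^ k" for k
    using cong_solve_coprime_int[OF cop[of k]] by (auto simp: cong_def)
  then obtain z where z: "\<And>k. residue x k * z k mod p ^ k = 1 mod p ^ k" by metis
  \<comment> \<open>Normalizing the arbitrary inverses makes those of neighbouring levels equal
    rather than merely congruent.\<close>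
  define y where "y k = z k mod p ^ k" for k
  have y: "residue x k * y k mod p ^ k = 1 mod p ^ k" for k
    using z[of k] by (simp add: y_def mod_simps)
  have "y (Suc k) mod p ^ k = y k" for k
  proof -
    have "residue x (Suc k) * y (Suc k) mod p ^ k = 1 mod p ^ k"
      using arg_cong[OF y[of "Suc k"], of "\<lambda>t. t mod p ^ k"]
      by (simp only: mod_Suc_power_mod)
    then have "residue x k * y (Suc k) mod p ^ k = residue x k * y k mod p ^ k"
      using y[of k] residue_mod_Suc[of x k] by (metis mod_mult_left_eq p_def)
    then have "y (Suc k) mod p ^ k = y k mod p ^ k"
      using cong_mult_lcancel[OF cop[of k]] by (simp add: cong_def)
    then show ?thesis by (simp add: y_def)
  qed
  then have res: "residue (Abs_padic_int y :: 'p padic_int) = y"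
    by (intro Abs_padic_int_inverse) (simp add: p_def)
  have "1 = x * Abs_padic_int y"
    by (rule residue_inject[THEN iffD1], rule ext)
      (use y in \<open>simp add: one_padic_int.rep_eq times_padic_int.rep_eq res p_def\<close>)
  then show ?thesis by (rule dvdI)
qed

lemma padic_val_ge_iff:
  fixes x :: "'p :: prime_card padic_int"
  assumes "x \<noteq> 0"
  shows "s \<le> padic_val x \<longleftrightarrow> uniformizer ^ s dvd x"
proof -
  have "uniformizer ^ padic_val x dvd x" "\<not> uniformizer ^ Suc (padic_val x) dvd x"
    using padic_val_residue[OF assms] unfolding residue_eq_0_iff by auto
  then show ?thesis
    by (meson dvd_trans le_imp_power_dvd not_less_eq_eq)
qed

lemma padic_int_norm_le_iff:
  fixes x :: "'p :: prime_card padic_int"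
  shows "padic_int_norm x \<le> 1 / real CARD('p) ^ s \<longleftrightarrow> uniformizer ^ s dvd x"
proof (cases "x = 0")
  case False
  have p: "real CARD('p) > 1"
    using prime_gt_1_nat[OF prime_card[where 'a = 'p]] by simp
  then have "padic_int_norm x \<le> 1 / real CARD('p) ^ s
      \<longleftrightarrow> real CARD('p) ^ s \<le> real CARD('p) ^ padic_val x"
    using False by (simp add: padic_int_norm_def field_simps)
  also have "\<dots> \<longleftrightarrow> s \<le> padic_val x" using p by simp
  finally show ?thesis using padic_val_ge_iff[OF False] by simp
qed (simp add: padic_int_norm_def)

text \<open>This identifies the ball of radius p^(-s) in the fraction field with p^s times the
  integers; in particular a small norm forces integrality. The denominator is split into a power of
  p and a unit.\<close>

lemma padic_norm_le_iff:
  fixes q :: "'p :: prime_card padic"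
  shows "padic_norm q \<le> 1 / real CARD('p) ^ s \<longleftrightarrow> (\<exists>x. q = to_fract (uniformizer ^ s * x))"
proof
  assume "\<exists>x. q = to_fract (uniformizer ^ s * x)"
  then obtain x where x: "q = to_fract (uniformizer ^ s * x)" ..
  have "padic_norm q = padic_int_norm (uniformizer ^ s * x) / padic_int_norm (1 :: 'p padic_int)"
    unfolding x to_fract_def by (rule padic_norm_Fract) simp
  \<comment> \<open>By multiplicativity this norm equals its own square, and it is nonzero.\<close>
  moreover have "padic_int_norm (1 :: 'p padic_int) = 1"
    using padic_int_norm_mult[of 1 "1 :: 'p padic_int"] padic_int_norm_eq_0_iff[of "1 :: 'p padic_int"] by simp
  ultimately show "padic_norm q \<le> 1 / real CARD('p) ^ s"
    by (simp add: padic_int_norm_le_iff)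
next
  assume le: "padic_norm q \<le> 1 / real CARD('p) ^ s"
  obtain a b where q: "q = Fract a b" and b: "b \<noteq> 0" by (cases q) auto
  define v where "v = padic_val b"
  have p: "real CARD('p) > 0"
    using prime_gt_0_nat[OF prime_card[where 'a = 'p]] by simp
  obtain c where c: "b = uniformizer ^ v * c"
    using padic_val_ge_iff[OF b, of v] by (auto simp: v_def)
  \<comment> \<open>The exponent \<open>v\<close> is the exact valuation of \<open>b\<close>, so the
    cofactor \<open>c\<close> is a unit, with inverse \<open>d\<close> below.\<close>
  have "\<not> uniformizer dvd c"
  proof
    assume "uniformizer dvd c"
    then have "uniformizer ^ Suc v dvd b" by (auto simp: c dvd_def)
    then show False using padic_val_ge_iff[OF b, of "Suc v"] by (simp add: v_def)
  qed
  then obtain d where d: "1 = c * d" using padic_int_unit by (auto simp: dvd_def)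
  have nb: "padic_int_norm b = 1 / real CARD('p) ^ v"
    using b by (simp add: padic_int_norm_def v_def)
  have "padic_int_norm a \<le> 1 / real CARD('p) ^ (s + v)"
    using le p unfolding q padic_norm_Fract[OF b] nb by (simp add: field_simps power_add)
  then obtain e where e: "a = uniformizer ^ (s + v) * e"
    by (auto simp: padic_int_norm_le_iff)
  have "a = uniformizer ^ s * (d * e) * b"
    using d by (simp add: e c power_add) (metis mult.commute mult.left_commute mult_1)
  then have "q = to_fract (uniformizer ^ s * (d * e))"
    unfolding q to_fract_def using b by (simp add: eq_fract)
  then show "\<exists>x. q = to_fract (uniformizer ^ s * x)" ..
qed

section \<open>Vectors of residues and bijectivity\<close>

lemma padic_vec_norm_le_iff:
  "padic_vec_norm q \<le> c \<longleftrightarrow> (\<forall>i. padic_norm (q $ i) \<le> c)"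
  unfolding padic_vec_norm_def by (subst Max_le_iff) auto

lemma vec_residue_eq_iff:
  fixes u v :: "'p :: prime_card padic_int ^ 'n"
  shows "vec_residue k u = vec_residue k v \<longleftrightarrow> (\<exists>w. u = v + uniformizer ^ k *s w)"
proof
  assume "vec_residue k u = vec_residue k v"
  then have "\<forall>i. \<exists>x. u $ i - v $ i = uniformizer ^ k * x"
    by (auto simp: vec_residue_def vec_eq_iff residue_eq_iff dvd_def)
  then obtain w where w: "\<And>i. u $ i - v $ i = uniformizer ^ k * w i" by metis
  have "u = v + uniformizer ^ k *s (\<chi> i. w i)"
    by (simp add: vec_eq_iff w[symmetric])
  then show "\<exists>w. u = v + uniformizer ^ k *s w" ..
qed (auto simp: vec_residue_def vec_eq_iff residue_eq_iff)

text \<open>After cancelling p^k only the displacement modulo p matters. This gives the fibre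
  between two consecutive levels its coordinates over the field with p elements.\<close>

lemma vec_residue_Suc_eq_iff:
  fixes u v w :: "'p :: prime_card padic_int ^ 'n"
  shows "vec_residue (Suc k) (u + uniformizer ^ k *s v)
      = vec_residue (Suc k) (u + uniformizer ^ k *s w)
    \<longleftrightarrow> (\<forall>i. uniformizer dvd v $ i - w $ i)"
proof -
  have "uniformizer ^ k * uniformizer dvd uniformizer ^ k * a \<longleftrightarrow> uniformizer dvd a"
    for a :: "'p padic_int"
    by (rule dvd_mult_cancel_left[THEN trans]) simp
  then show ?thesis
    by (simp add: vec_residue_def vec_eq_iff residue_eq_iff mult.commute[of uniformizer]
        flip: right_diff_distrib)
qed

lemma vec_residue_le:
  fixes u v :: "'p :: prime_card padic_int ^ 'n"
  assumes "vec_residue m u = vec_residue m v" "k \<le> m"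
  shows "vec_residue k u = vec_residue k v"
proof -
  have "residue (u $ i) k = residue (v $ i) k" for i
    using assms(1) residue_mod[OF assms(2), of "u $ i"] residue_mod[OF assms(2), of "v $ i"]
    by (simp add: vec_residue_def vec_eq_iff)
  then show ?thesis by (simp add: vec_residue_def vec_eq_iff)
qed

lemma vec_residue_in_box:
  "vec_residue k (u :: 'p :: prime_card padic_int ^ 'n) \<in> residue_box TYPE('p) k"
proof -
  have "0 \<le> residue x k \<and> residue x k < int CARD('p) ^ k" for x :: "'p padic_int"
  proof -
    have "int CARD('p) ^ k > 0"
      using prime_gt_0_nat[OF prime_card[where 'a = 'p]] by simp
    then show ?thesis
      using pos_mod_bound[of "int CARD('p) ^ k" "residue x k"]
        pos_mod_sign[of "int CARD('p) ^ k" "residue x k"] by simp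
  qed
  then show ?thesis by (simp add: vec_residue_def residue_box_def)
qed

lemma vec_residue_padic_vec_of_int:
  fixes x :: "int ^ 'n"
  assumes "x \<in> residue_box TYPE('p :: prime_card) k"
  shows "vec_residue k (padic_vec_of_int x :: 'p padic_int ^ 'n) = x"
  using assms by (simp add: vec_residue_def padic_vec_of_int_def residue_box_def vec_eq_iff
      residue_of_int)

lemma finite_residue_box: "finite (residue_box TYPE('p :: prime_card) k :: (int ^ 'n) set)"
proof -
  have "residue_box TYPE('p) k \<subseteq>
      vec_lambda ` (UNIV \<rightarrow>\<^sub>E {0..<int CARD('p) ^ k} :: ('n \<Rightarrow> int) set)"
    by (auto simp: residue_box_def PiE_UNIV_domain intro!: image_eqI[where x = "vec_nth _"])
  then show ?thesis by (rule finite_subset) (intro finite_imageI finite_PiE; simp)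
qed

section \<open>Bijectivity modulo p^k via the induced map on residue classes\<close>

context
  fixes F :: "'p :: prime_card padic_int ^ 'n \<Rightarrow> 'p padic_int ^ 'n" and k :: nat
  assumes compat: "\<And>u v. vec_residue k u = vec_residue k v
    \<Longrightarrow> vec_residue k (F u) = vec_residue k (F v)"
begin

text \<open>An injective self-map of the finite box is bijective, and \<open>compat\<close> allows
  arbitrary p-adic vectors in place of the integer representatives.\<close>

lemma bijective_mod_iff_inj:
  "bijective_mod k F \<longleftrightarrow>
    (\<forall>u v. vec_residue k (F u) = vec_residue k (F v) \<longrightarrow> vec_residue k u = vec_residue k v)"
    (is "_ \<longleftrightarrow> ?inj")
proof -
  let ?B = "residue_box TYPE('p) k :: (int ^ 'n) set"
  let ?f = "\<lambda>x. vec_residue k (F (padic_vec_of_int x))"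
  \<comment> \<open>A vector and the integer representative of its class have the same residue, so
    \<open>compat\<close> applies.\<close>
  have f: "?f (vec_residue k u) = vec_residue k (F u)" for u
    by (rule compat, rule vec_residue_padic_vec_of_int, rule vec_residue_in_box)
  have "bijective_mod k F \<longleftrightarrow> inj_on ?f ?B"
  proof
    assume inj: "inj_on ?f ?B"
    have "?f ` ?B = ?B"
      by (rule endo_inj_surj[OF finite_residue_box _ inj]) (auto simp: vec_residue_in_box)
    with inj show "bijective_mod k F" by (simp add: bijective_mod_def bij_betw_def)
  qed (simp add: bijective_mod_def bij_betw_def)
  also have "\<dots> \<longleftrightarrow> ?inj"
  proof
    assume inj: "inj_on ?f ?B"
    show ?inj
    proof (intro allI impI)
      fix u v assume "vec_residue k (F u) = vec_residue k (F v)"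
      then have "?f (vec_residue k u) = ?f (vec_residue k v)" by (simp only: f)
      then show "vec_residue k u = vec_residue k v"
        using inj by (auto dest: inj_onD intro: vec_residue_in_box)
    qed
  next
    assume inj: ?inj
    show "inj_on ?f ?B"
    proof (rule inj_onI)
      fix x y assume xy: "x \<in> ?B" "y \<in> ?B" and eq: "?f x = ?f y"
      have "vec_residue k (padic_vec_of_int x :: 'p padic_int ^ 'n)
          = vec_residue k (padic_vec_of_int y :: 'p padic_int ^ 'n)"
        using inj eq by blast
      then show "x = y" by (simp only: vec_residue_padic_vec_of_int xy)
    qed
  qed
  finally show ?thesis .
qed

text \<open>Surjectivity, unlike injectivity, passes directly from level k + 1 down to level k,
  which is why both characterizations are kept.\<close>

lemma bijective_mod_iff_surj:
  "bijective_mod k F \<longleftrightarrow> (\<forall>v :: 'p padic_int ^ 'n. \<exists>u. vec_residue k (F u) = vec_residue k v)"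
proof -
  let ?B = "residue_box TYPE('p) k :: (int ^ 'n) set"
  let ?f = "\<lambda>x. vec_residue k (F (padic_vec_of_int x))"
  have f: "?f (vec_residue k u) = vec_residue k (F u)" for u
    by (rule compat, rule vec_residue_padic_vec_of_int, rule vec_residue_in_box)
  show ?thesis
  proof
    assume "bijective_mod k F"
    then have img: "?f ` ?B = ?B" by (simp add: bijective_mod_def bij_betw_def)
    show "\<forall>v :: 'p padic_int ^ 'n. \<exists>u. vec_residue k (F u) = vec_residue k v"
    proof
      fix v :: "'p padic_int ^ 'n"
      have "vec_residue k v \<in> ?f ` ?B"
        unfolding img by (rule vec_residue_in_box)
      then show "\<exists>u. vec_residue k (F u) = vec_residue k v" by auto
    qed
  next
    assume surj: "\<forall>v :: 'p padic_int ^ 'n. \<exists>u. vec_residue k (F u) = vec_residue k v"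
    have sub: "?B \<subseteq> ?f ` ?B"
    proof
      fix x assume "x \<in> ?B"
      then obtain u where "vec_residue k (F u) = x"
        using surj vec_residue_padic_vec_of_int[of x k, where 'p = 'p] by metis
      then have "x = ?f (vec_residue k u)" by (simp only: f)
      then show "x \<in> ?f ` ?B" using vec_residue_in_box by blast
    qed
    moreover have "?f ` ?B \<subseteq> ?B" by (auto simp: vec_residue_in_box)
    ultimately show "bijective_mod k F"
      unfolding bijective_mod_def bij_betw_def
      using finite_surj_inj[OF finite_residue_box] by blast
  qed
qed

end

section \<open>Determinants modulo p\<close>

lemma axis_vector_matrix_mult: "(axis i 1 v* M) $ j = M $ i $ j"
proof -
  have "(axis i 1 v* M) $ j = (\<Sum>l\<in>UNIV. if l = i then M $ l $ j else 0)"
    unfolding vector_matrix_mult_def vec_lambda_beta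
    by (intro sum.cong) (simp_all add: axis_def)
  then show ?thesis by simp
qed

lemma (in comm_ring_hom) hom_det: "hom (det A) = det (map_matrix hom A)"
  by (simp add: det_def hom_sum hom_prod hom_mult hom_of_int)

lemma (in comm_ring_hom) hom_vector_matrix_mult:
  "hom ((w v* A) $ j) = ((\<chi> i. hom (w $ i)) v* map_matrix hom A) $ j"
  by (simp add: vector_matrix_mult_def hom_sum hom_mult)

interpretation to_fract_hom: comm_ring_hom "to_fract :: 'a :: idom \<Rightarrow> 'a fract"
  by unfold_locales simp_all

text \<open>The residue map onto the field with p elements; the target \<open>'p mod_ring\<close> is
  a field type, so linear algebra over fields applies to it.\<close>

definition reduction_mod_p :: "'p :: prime_card padic_int \<Rightarrow> 'p mod_ring" where
  "reduction_mod_p x = of_int (residue x 1)"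

lemma of_int_mod_card:
  "of_int (a mod int CARD('p)) = (of_int a :: 'p :: prime_card mod_ring)"
  unfolding of_int_of_int_mod_ring by transfer simp

interpretation reduction_mod_p_hom:
  comm_ring_hom "reduction_mod_p :: 'p :: prime_card padic_int \<Rightarrow> 'p mod_ring"
  by unfold_locales (simp_all add: reduction_mod_p_def zero_padic_int.rep_eq
      one_padic_int.rep_eq plus_padic_int.rep_eq times_padic_int.rep_eq of_int_mod_card)

lemma reduction_mod_p_eq_0_iff: "reduction_mod_p x = 0 \<longleftrightarrow> uniformizer dvd x"
  for x :: "'p :: prime_card padic_int"
proof -
  have "reduction_mod_p x = 0 \<longleftrightarrow> residue x 1 mod int CARD('p) = 0"
    unfolding reduction_mod_p_def of_int_of_int_mod_ring by transfer simp
  also have "\<dots> \<longleftrightarrow> residue x 1 = 0"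
    using residue_mod_self[of x 1] by simp
  finally show ?thesis by (simp add: residue_eq_0_iff)
qed

lemma surj_reduction_mod_p: "surj (reduction_mod_p :: 'p :: prime_card padic_int \<Rightarrow> _)"
proof (rule surjI)
  fix a :: "'p mod_ring"
  show "reduction_mod_p (of_int (to_int_mod_ring a) :: 'p padic_int) = a"
    by (simp add: reduction_mod_p_def residue_of_int of_int_mod_card)
      (simp add: of_int_of_int_mod_ring)
qed

text \<open>Row vectors act from the left here, so the kernel criterion for column vectors is
  applied to the transpose.\<close>

lemma det_nonzero_iff_left_kernel:
  fixes A :: "'a :: field ^ 'n ^ 'n"
  shows "det A \<noteq> 0 \<longleftrightarrow> (\<forall>w. w v* A = 0 \<longrightarrow> w = 0)"
proof -
  have "det A \<noteq> 0 \<longleftrightarrow> invertible (transpose A)"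
    by (simp add: invertible_det_nz)
  also have "\<dots> \<longleftrightarrow> (\<forall>w. transpose A *v w = 0 \<longrightarrow> w = 0)"
    by (simp add: invertible_left_inverse matrix_left_invertible_ker)
  finally show ?thesis by simp
qed

text \<open>The field criterion is pulled back along reduction modulo p: determinants and products
  commute with the ring homomorphism, and every vector over the residue field lifts.\<close>

lemma det_unit_iff_left_kernel:
  fixes A :: "'p :: prime_card padic_int ^ 'n ^ 'n"
  shows "\<not> uniformizer dvd det A \<longleftrightarrow>
    (\<forall>w. (\<forall>j. uniformizer dvd (w v* A) $ j) \<longrightarrow> (\<forall>i. uniformizer dvd w $ i))"
proof -
  define red :: "'p padic_int ^ 'n \<Rightarrow> 'p mod_ring ^ 'n"
    where "red w = (\<chi> i. reduction_mod_p (w $ i))" for w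
  have surj: "surj red"
  proof (rule surjI)
    fix v
    show "red (\<chi> i. inv_into UNIV reduction_mod_p (v $ i)) = v"
      by (simp add: red_def vec_eq_iff surj_f_inv_f[OF surj_reduction_mod_p])
  qed
  have red_0: "red w = 0 \<longleftrightarrow> (\<forall>i. uniformizer dvd w $ i)" for w
    by (simp add: red_def vec_eq_iff reduction_mod_p_eq_0_iff)
  have red_mult: "red (w v* A) = red w v* map_matrix reduction_mod_p A" for w
    by (simp add: red_def vec_eq_iff reduction_mod_p_hom.hom_vector_matrix_mult)
  have "\<not> uniformizer dvd det A \<longleftrightarrow> det (map_matrix reduction_mod_p A) \<noteq> 0"
    by (simp add: reduction_mod_p_eq_0_iff[symmetric] reduction_mod_p_hom.hom_det)
  also have "\<dots> \<longleftrightarrow> (\<forall>w. red w v* map_matrix reduction_mod_p A = 0 \<longrightarrow> red w = 0)"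
    unfolding det_nonzero_iff_left_kernel using surj by (metis surjD)
  finally show ?thesis by (simp add: red_mult[symmetric] red_0)
qed

section \<open>Integral Jacobi matrices modulo p\<close>

lemma padic_vec_norm_le_iff_multiple:
  fixes h :: "'p :: prime_card padic_int ^ 'n"
  shows "padic_vec_norm (vec_of_padic_int h) \<le> 1 / real CARD('p) ^ K
    \<longleftrightarrow> (\<exists>w. h = uniformizer ^ K *s w)"
proof -
  have "padic_vec_norm (vec_of_padic_int h) \<le> 1 / real CARD('p) ^ K
      \<longleftrightarrow> (\<forall>i. \<exists>x. h $ i = uniformizer ^ K * x)"
    by (simp add: padic_vec_norm_le_iff padic_norm_le_iff vec_of_padic_int_def
        flip: to_fract_mult)
  also have "\<dots> \<longleftrightarrow> (\<exists>w. \<forall>i. h $ i = uniformizer ^ K * w i)" by metis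
  also have "\<dots> \<longleftrightarrow> (\<exists>w. h = uniformizer ^ K *s w)"
    by (auto simp: vec_eq_iff) (metis vec_lambda_beta)
  finally show ?thesis .
qed

text \<open>Substituting h = p^K w removes the norms. The equation stays in the fraction field
  because \<open>J u\<close> may still have fractional entries.\<close>

lemma jacobi_mod_from_iff:
  fixes F :: "'p :: prime_card padic_int ^ 'n \<Rightarrow> 'p padic_int ^ 'n"
  shows "jacobi_mod_from 1 N F J \<longleftrightarrow> (\<forall>K\<ge>N. \<forall>u w j. \<exists>x.
    to_fract (F (u + uniformizer ^ K *s w) $ j) - (to_fract (F u $ j)
      + to_fract (uniformizer ^ K) * (vec_of_padic_int w v* J u) $ j)
    = to_fract (uniformizer ^ Suc K * x))"
proof -
  have scale: "(vec_of_padic_int (uniformizer ^ K *s w) v* J u) $ j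
      = to_fract (uniformizer ^ K) * (vec_of_padic_int w v* J u) $ j"
    for K u j and w :: "'p padic_int ^ 'n"
    by (simp add: vec_of_padic_int_def vector_matrix_mult_def sum_distrib_left mult.assoc)
  have cong: "padic_vec_cong (1 + K) (vec_of_padic_int (F (u + h)))
        (vec_of_padic_int (F u) + vec_of_padic_int h v* J u)
      \<longleftrightarrow> (\<forall>j. \<exists>x. to_fract (F (u + h) $ j) - (to_fract (F u $ j)
        + (vec_of_padic_int h v* J u) $ j) = to_fract (uniformizer ^ Suc K * x))" for K u h
    unfolding padic_vec_cong_def padic_vec_norm_le_iff padic_norm_le_iff
    by (simp add: vec_of_padic_int_def del: to_fract_mult power_Suc)
  show ?thesis
    unfolding jacobi_mod_from_def padic_vec_norm_le_iff_multiple cong scale[symmetric] by blast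
qed

text \<open>For integral matrices the approximation property modulo p is an equality of residues
  modulo p^(K+1), with w standing for h / p^K.\<close>

definition integral_jacobi_from ::
  "nat \<Rightarrow> ('p :: prime_card padic_int ^ 'n \<Rightarrow> 'p padic_int ^ 'n)
    \<Rightarrow> ('p padic_int ^ 'n \<Rightarrow> 'p padic_int ^ 'n ^ 'n) \<Rightarrow> bool" where
  "integral_jacobi_from N F A \<longleftrightarrow> (\<forall>K\<ge>N. \<forall>u w.
    vec_residue (Suc K) (F (u + uniformizer ^ K *s w))
      = vec_residue (Suc K) (F u + uniformizer ^ K *s (w v* A u)))"

lemma jacobi_mod_from_to_fract_iff:
  "jacobi_mod_from 1 N F (\<lambda>u. map_matrix to_fract (A u)) \<longleftrightarrow> integral_jacobi_from N F A"
proof -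
  have "(vec_of_padic_int w v* map_matrix to_fract (A u)) $ j = to_fract ((w v* A u) $ j)" for w u j
    by (simp add: to_fract_hom.hom_vector_matrix_mult vec_of_padic_int_def)
  then show ?thesis
    unfolding jacobi_mod_from_iff integral_jacobi_from_def
    by (simp add: vec_residue_def vec_eq_iff residue_eq_iff dvd_def
        flip: to_fract_mult to_fract_add to_fract_diff)
qed

text \<open>Both approximations are tested on p^K times the i-th unit vector, which isolates row i;
  subtracting them and cancelling p^K leaves a multiple of p.\<close>

lemma jacobi_mod_from_unique:
  fixes F :: "'p :: prime_card padic_int ^ 'n \<Rightarrow> 'p padic_int ^ 'n"
  assumes "jacobi_mod_from 1 N F J" "jacobi_mod_from 1 N' F J'"
  shows "\<exists>x. J u $ i $ j = J' u $ i $ j + to_fract (uniformizer * x)"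
proof -
  \<comment> \<open>At this exponent both approximation properties are available.\<close>
  define K where "K = max N N'"
  define w :: "'p padic_int ^ 'n" where "w = axis i 1"
  have "vec_of_padic_int w = axis i 1"
    by (simp add: vec_of_padic_int_def w_def axis_def vec_eq_iff)
  then have row: "(vec_of_padic_int w v* M) $ j = M $ i $ j" for M :: "'p padic ^ 'n ^ 'n"
    by (simp add: axis_vector_matrix_mult)
  define P :: "'p padic" where "P = to_fract (uniformizer ^ K)"
  have P: "P \<noteq> 0" by (simp add: P_def)
  define a where "a = to_fract (F (u + uniformizer ^ K *s w) $ j) - to_fract (F u $ j)"
  have "\<exists>x. to_fract (F (u + uniformizer ^ K *s w) $ j) - (to_fract (F u $ j)
      + to_fract (uniformizer ^ K) * (vec_of_padic_int w v* J u) $ j)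
    = to_fract (uniformizer ^ Suc K * x)"
    using assms(1) unfolding jacobi_mod_from_iff by (simp add: K_def)
  then obtain x where x: "a - P * J u $ i $ j = P * to_fract (uniformizer * x)"
    unfolding row by (auto simp: a_def P_def algebra_simps)
  have "\<exists>x. to_fract (F (u + uniformizer ^ K *s w) $ j) - (to_fract (F u $ j)
      + to_fract (uniformizer ^ K) * (vec_of_padic_int w v* J' u) $ j)
    = to_fract (uniformizer ^ Suc K * x)"
    using assms(2) unfolding jacobi_mod_from_iff by (simp add: K_def)
  then obtain y where y: "a - P * J' u $ i $ j = P * to_fract (uniformizer * y)"
    unfolding row by (auto simp: a_def P_def algebra_simps)
  have "P * J u $ i $ j = P * (J' u $ i $ j + to_fract (uniformizer * (y - x)))"
    using x y by (simp add: algebra_simps)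
  then have "J u $ i $ j = J' u $ i $ j + to_fract (uniformizer * (y - x))"
    using P by (metis mult_left_cancel)
  then show ?thesis ..
qed

text \<open>A change of the matrix by multiples of p moves p^K w A by a multiple of p^(K+1), which
  is invisible at level K + 1.\<close>

lemma integral_jacobi_from_cong:
  fixes A B :: "'p :: prime_card padic_int ^ 'n \<Rightarrow> 'p padic_int ^ 'n ^ 'n"
  assumes "integral_jacobi_from N F A" and dvd: "\<And>u i j. uniformizer dvd A u $ i $ j - B u $ i $ j"
  shows "integral_jacobi_from N F B"
  unfolding integral_jacobi_from_def
proof (intro allI impI)
  fix K :: nat and u w :: "'p padic_int ^ 'n"
  assume "N \<le> K"
  then have "vec_residue (Suc K) (F (u + uniformizer ^ K *s w))
      = vec_residue (Suc K) (F u + uniformizer ^ K *s (w v* A u))"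
    using assms(1) by (simp add: integral_jacobi_from_def)
  also have "\<dots> = vec_residue (Suc K) (F u + uniformizer ^ K *s (w v* B u))"
  proof -
    have "uniformizer dvd (w v* A u) $ j - (w v* B u) $ j" for j
    proof -
      have "(w v* A u) $ j - (w v* B u) $ j = (\<Sum>i\<in>UNIV. w $ i * (A u $ i $ j - B u $ i $ j))"
        by (simp add: vector_matrix_mult_def sum_subtractf right_diff_distrib)
      also have "uniformizer dvd \<dots>" by (intro dvd_sum dvd_mult dvd)
      finally show ?thesis .
    qed
    then show ?thesis
      by (simp add: vec_residue_def vec_eq_iff residue_eq_iff flip: right_diff_distrib)
  qed
  finally show "vec_residue (Suc K) (F (u + uniformizer ^ K *s w))
      = vec_residue (Suc K) (F u + uniformizer ^ K *s (w v* B u))" .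
qed

text \<open>An arbitrary Jacobi matrix differs from an integral one by integral multiples of p,
  hence is integral itself.\<close>

lemma jacobi_mod_integral:
  fixes F :: "'p :: prime_card padic_int ^ 'n \<Rightarrow> 'p padic_int ^ 'n"
  assumes "integer_valued_derivatives_mod 1 F" "jacobi_mod 1 F J"
  obtains A where "J = (\<lambda>u. map_matrix to_fract (A u))"
proof -
  obtain N' J' where J': "jacobi_mod_from 1 N' F J'"
    and int: "\<And>u i j. J' u $ i $ j \<in> range to_fract"
    using assms(1) by (auto simp: integer_valued_derivatives_mod_def jacobi_mod_def)
  obtain N where J: "jacobi_mod_from 1 N F J"
    using assms(2) by (auto simp: jacobi_mod_def)
  have "\<exists>y. J u $ i $ j = to_fract y" for u i j
    using jacobi_mod_from_unique[OF J J', of u i j] int[of u i j]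
    by (metis imageE to_fract_add)
  then obtain A where A: "\<And>u i j. J u $ i $ j = to_fract (A u i j)" by metis
  have "J = (\<lambda>u. map_matrix to_fract (\<chi> i j. A u i j))"
    by (simp add: fun_eq_iff vec_eq_iff A)
  then show ?thesis by (rule that)
qed

text \<open>The least N is attained by some family \<open>B\<close>, possibly different from
  \<open>A\<close>. The two agree modulo p, so \<open>A\<close> inherits the same N.\<close>

lemma integral_jacobi_from_least_N:
  fixes F :: "'p :: prime_card padic_int ^ 'n \<Rightarrow> 'p padic_int ^ 'n"
  assumes int: "integer_valued_derivatives_mod 1 F"
    and A: "jacobi_mod 1 F (\<lambda>u. map_matrix to_fract (A u))"
  shows "integral_jacobi_from (least_N 1 F) F A"
proof -
  obtain N where N: "jacobi_mod_from 1 N F (\<lambda>u. map_matrix to_fract (A u))"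
    using A by (auto simp: jacobi_mod_def)
  then have "\<exists>N J. jacobi_mod_from 1 N F J" by blast
  then obtain J where J: "jacobi_mod_from 1 (least_N 1 F) F J"
    unfolding least_N_def by (rule LeastI_ex[THEN exE])
  then obtain B where B: "J = (\<lambda>u. map_matrix to_fract (B u))"
    using jacobi_mod_integral[OF int, of J] by (auto simp: jacobi_mod_def)
  have "uniformizer dvd B u $ i $ j - A u $ i $ j" for u i j
    using jacobi_mod_from_unique[OF J N, of u i j]
    by (auto simp: B simp flip: to_fract_mult to_fract_add)
  moreover have "integral_jacobi_from (least_N 1 F) F B"
    using J unfolding B jacobi_mod_from_to_fract_iff .
  ultimately show ?thesis by (rule integral_jacobi_from_cong[rotated])
qed

section \<open>Lifting bijectivity\<close>

context
  fixes F :: "'p :: prime_card padic_int ^ 'n \<Rightarrow> 'p padic_int ^ 'n" and A N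
  assumes jacobi: "integral_jacobi_from N F A"
begin

lemma integral_jacobi_step:
  assumes "N \<le> k"
  shows "vec_residue (Suc k) (F (u + uniformizer ^ k *s w))
    = vec_residue (Suc k) (F u + uniformizer ^ k *s (w v* A u))"
  using jacobi assms by (simp add: integral_jacobi_from_def)

text \<open>Reduced modulo p^k, the linear term p^k w A vanishes. Thus F induces a map on residue
  classes at every level from N on.\<close>

lemma integral_jacobi_compat:
  assumes "N \<le> k" "vec_residue k u = vec_residue k v"
  shows "vec_residue k (F u) = vec_residue k (F v)"
proof -
  obtain w where w: "u = v + uniformizer ^ k *s w"
    using assms(2) vec_residue_eq_iff by blast
  have "vec_residue k (F u) = vec_residue k (F v + uniformizer ^ k *s (w v* A v))"
    unfolding w by (rule vec_residue_le[OF integral_jacobi_step[OF assms(1)]]) simp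
  also have "\<dots> = vec_residue k (F v)"
    unfolding vec_residue_eq_iff by blast
  finally show ?thesis .
qed

text \<open>The value of F at v + p^N (h + e) is expanded twice modulo p^(N+1): once from v, and
  once from u = v + p^N h with displacement e. Comparing the two leaves e A(v) and e A(u) congruent
  modulo p.\<close>

lemma integral_jacobi_periodic:
  assumes "vec_residue N u = vec_residue N v"
  shows "uniformizer dvd A u $ i $ j - A v $ i $ j"
proof -
  obtain h where h: "u = v + uniformizer ^ N *s h"
    using assms vec_residue_eq_iff by blast
  define e :: "'p padic_int ^ 'n" where "e = axis i 1"
  have cong: "vec_residue (Suc N) (F u) = vec_residue (Suc N) (F v + uniformizer ^ N *s (h v* A v))"
    unfolding h by (rule integral_jacobi_step) simp
  have "vec_residue (Suc N) (F v + uniformizer ^ N *s ((h + e) v* A v))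
      = vec_residue (Suc N) (F (v + uniformizer ^ N *s (h + e)))"
    by (rule integral_jacobi_step[symmetric]) simp
  also have "v + uniformizer ^ N *s (h + e) = u + uniformizer ^ N *s e"
    by (simp add: h vec_eq_iff algebra_simps)
  also have "vec_residue (Suc N) (F \<dots>)
      = vec_residue (Suc N) (F u + uniformizer ^ N *s (e v* A u))"
    by (rule integral_jacobi_step) simp
  also have "\<dots> = vec_residue (Suc N)
      (F v + uniformizer ^ N *s (h v* A v) + uniformizer ^ N *s (e v* A u))"
    using cong by (simp add: vec_residue_def vec_eq_iff residue_eq_iff)
  also have "\<dots> = vec_residue (Suc N) (F v + uniformizer ^ N *s (h v* A v + e v* A u))"
    by (rule arg_cong[where f = "vec_residue (Suc N)"]) (simp add: vec_eq_iff algebra_simps)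
  finally have "\<forall>l. uniformizer dvd ((h + e) v* A v) $ l - (h v* A v + e v* A u) $ l"
    unfolding vec_residue_Suc_eq_iff .
  then have "uniformizer dvd ((h + e) v* A v) $ j - (h v* A v + e v* A u) $ j" ..
  then have "uniformizer dvd A v $ i $ j - A u $ i $ j"
    by (simp add: vector_matrix_left_distrib e_def axis_vector_matrix_mult)
  then show ?thesis by (metis dvd_minus_iff minus_diff_eq)
qed

lemma det_integral_jacobi_periodic:
  assumes "vec_residue N u = vec_residue N v"
  shows "uniformizer dvd det (A u) \<longleftrightarrow> uniformizer dvd det (A v)"
proof -
  have "reduction_mod_p (A u $ i $ j) = reduction_mod_p (A v $ i $ j)" for i j
    using integral_jacobi_periodic[OF assms, of i j] reduction_mod_p_eq_0_iff
    by (metis reduction_mod_p_hom.hom_add add.left_neutral diff_add_cancel)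
  then have "map_matrix reduction_mod_p (A u) = map_matrix reduction_mod_p (A v)"
    by (simp add: vec_eq_iff)
  then show ?thesis
    by (simp add: reduction_mod_p_hom.hom_det flip: reduction_mod_p_eq_0_iff)
qed

text \<open>Going down, surjectivity is inherited and injectivity within one fibre gives a trivial
  left kernel. Going up, equal images force equal classes modulo p^k, and the trivial kernel then
  separates points within the fibre.\<close>

lemma bijective_mod_Suc_iff:
  assumes k: "N \<le> k"
  shows "bijective_mod (Suc k) F \<longleftrightarrow>
    bijective_mod k F \<and> (\<forall>u. \<not> uniformizer dvd det (A u))"
proof -
  have compat: "vec_residue l (F u) = vec_residue l (F v)"
    if "vec_residue l u = vec_residue l v" "k \<le> l" for l u v
    using integral_jacobi_compat[OF _ that(1)] that(2) k by simp
  have inj_iff: "bijective_mod l F \<longleftrightarrow>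
      (\<forall>u v. vec_residue l (F u) = vec_residue l (F v) \<longrightarrow> vec_residue l u = vec_residue l v)"
    if "k \<le> l" for l
    by (rule bijective_mod_iff_inj) (rule compat[OF _ that])
  have surj_iff: "bijective_mod l F \<longleftrightarrow>
      (\<forall>v :: 'p padic_int ^ 'n. \<exists>u. vec_residue l (F u) = vec_residue l v)"
    if "k \<le> l" for l
    by (rule bijective_mod_iff_surj) (rule compat[OF _ that])
  \<comment> \<open>\<open>step\<close> and \<open>triv\<close> compare a displacement p^k w with
    the zero displacement, on the image side and on the argument side: the first describes the left
    kernel of \<open>A u\<close> modulo p, the second its zero vector.\<close>
  have step: "vec_residue (Suc k) (F (u + uniformizer ^ k *s w)) = vec_residue (Suc k) (F u)
      \<longleftrightarrow> (\<forall>j. uniformizer dvd (w v* A u) $ j)" for u w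
    unfolding integral_jacobi_step[OF k]
    using vec_residue_Suc_eq_iff[of k "F u" "w v* A u" 0] by simp
  have triv: "vec_residue (Suc k) (u + uniformizer ^ k *s w) = vec_residue (Suc k) u
      \<longleftrightarrow> (\<forall>j. uniformizer dvd w $ j)" for u w :: "'p padic_int ^ 'n"
    using vec_residue_Suc_eq_iff[of k u w 0] by simp
  show ?thesis
  proof (intro iffI conjI allI)
    assume bij: "bijective_mod (Suc k) F"
    show "bijective_mod k F"
      unfolding surj_iff[OF order_refl]
    proof
      fix v :: "'p padic_int ^ 'n"
      obtain u where "vec_residue (Suc k) (F u) = vec_residue (Suc k) v"
        using bij surj_iff[of "Suc k"] by auto
      then have "vec_residue k (F u) = vec_residue k v"
        by (rule vec_residue_le) simp
      then show "\<exists>u. vec_residue k (F u) = vec_residue k v" ..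
    qed
    from bij have inj: "\<forall>u v. vec_residue (Suc k) (F u) = vec_residue (Suc k) (F v)
        \<longrightarrow> vec_residue (Suc k) u = vec_residue (Suc k) v"
      unfolding inj_iff[OF le_SucI[OF order_refl]] .
    fix u
    show "\<not> uniformizer dvd det (A u)"
      unfolding det_unit_iff_left_kernel using inj step triv by blast
  next
    assume *: "bijective_mod k F \<and> (\<forall>u. \<not> uniformizer dvd det (A u))"
    then have inj: "\<forall>u v. vec_residue k (F u) = vec_residue k (F v)
        \<longrightarrow> vec_residue k u = vec_residue k v"
      unfolding inj_iff[OF order_refl] by (rule conjunct1)
    have "vec_residue (Suc k) u = vec_residue (Suc k) v"
      if eq: "vec_residue (Suc k) (F u) = vec_residue (Suc k) (F v)" for u v
    proof -
      have "vec_residue k u = vec_residue k v"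
        by (rule inj[rule_format]) (rule vec_residue_le[OF eq], simp)
      then obtain w where w: "u = v + uniformizer ^ k *s w"
        using vec_residue_eq_iff by blast
      show ?thesis
        using eq * unfolding w step triv det_unit_iff_left_kernel by blast
    qed
    then show "bijective_mod (Suc k) F"
      unfolding inj_iff[OF le_SucI[OF order_refl]] by blast
  qed
qed

text \<open>The determinant condition is the same at all levels, so each further lifting step adds
  nothing. The induction starts at \<open>Suc N\<close>, the first level reached by a lifting
  step.\<close>

lemma bijective_mod_ge_iff:
  assumes "N < k"
  shows "bijective_mod k F \<longleftrightarrow> bijective_mod N F \<and> (\<forall>u. \<not> uniformizer dvd det (A u))"
  using Suc_leI[OF assms]
proof (induction k rule: dec_induct)
  case base
  show ?case by (rule bijective_mod_Suc_iff) simp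
next
  case (step k)
  then show ?case using bijective_mod_Suc_iff[of k] by simp
qed

text \<open>For all k > N bijectivity modulo p^k is equivalent to one condition free of k, so
  holding eventually means holding outright.\<close>

lemma asymptotically_measure_preserving_iff:
  "asymptotically_measure_preserving F \<longleftrightarrow>
    bijective_mod N F \<and> (\<forall>u. \<not> uniformizer dvd det (A u))"
proof -
  have "\<forall>\<^sub>F k in sequentially. bijective_mod k F \<longleftrightarrow>
      bijective_mod N F \<and> (\<forall>u. \<not> uniformizer dvd det (A u))"
    using eventually_gt_at_top[of N] by eventually_elim (rule bijective_mod_ge_iff)
  then have "asymptotically_measure_preserving F \<longleftrightarrow> (\<forall>\<^sub>F k in sequentially.
      bijective_mod N F \<and> (\<forall>u. \<not> uniformizer dvd det (A u)))"
    unfolding asymptotically_measure_preserving_def by (rule eventually_cong) simp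
  then show ?thesis by simp
qed

end

lemma padic_cong_1_iff:
  fixes x :: "'p :: prime_card padic_int"
  shows "padic_cong 1 (to_fract x) 0 \<longleftrightarrow> uniformizer dvd x"
  unfolding padic_cong_def padic_norm_le_iff
  by (auto simp: dvd_def simp flip: to_fract_mult)

text \<open>Jacobi matrices modulo p are determined only up to multiples of p, so the first
  equivalence is asserted for every choice of them.\<close>

theorem theorem3p9:
  fixes F :: "'p :: prime_card padic_int ^ 'n \<Rightarrow> 'p padic_int ^ 'n"
  assumes "uniformly_differentiable_mod 1 F"
    and "integer_valued_derivatives_mod 1 F"
  shows "(\<forall>F\<^sub>1'. jacobi_mod 1 F F\<^sub>1' \<longrightarrow>
      (asymptotically_measure_preserving F \<longleftrightarrow>
        bijective_mod (least_N 1 F) F \<and>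
        (\<forall>u \<in> residue_box TYPE('p) (least_N 1 F).
          \<not> padic_cong 1 (det (F\<^sub>1' (padic_vec_of_int u))) 0))) \<and>
    (asymptotically_measure_preserving F \<longleftrightarrow> bijective_mod (least_N 1 F + 1) F)"
proof -
  let ?N = "least_N 1 F"
  have equiv: "(asymptotically_measure_preserving F \<longleftrightarrow>
        bijective_mod ?N F \<and>
        (\<forall>u \<in> residue_box TYPE('p) ?N. \<not> padic_cong 1 (det (J (padic_vec_of_int u))) 0)) \<and>
    (asymptotically_measure_preserving F \<longleftrightarrow> bijective_mod (?N + 1) F)"
    if J: "jacobi_mod 1 F J" for J
  proof -
    obtain A where A: "J = (\<lambda>u. map_matrix to_fract (A u))"
      using jacobi_mod_integral[OF assms(2) J] .
    have jac: "integral_jacobi_from ?N F A"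
      using integral_jacobi_from_least_N[OF assms(2)] J unfolding A .
    have det: "padic_cong 1 (det (J u)) 0 \<longleftrightarrow> uniformizer dvd det (A u)" for u
      by (simp only: A flip: to_fract_hom.hom_det padic_cong_1_iff)
    \<comment> \<open>Each vector has the same residue modulo p^N as its representative in the box,
      and divisibility of the determinant by p depends only on that residue.\<close>
    have "(\<forall>u. \<not> uniformizer dvd det (A u)) \<longleftrightarrow>
        (\<forall>u \<in> residue_box TYPE('p) ?N. \<not> uniformizer dvd det (A (padic_vec_of_int u)))"
      using det_integral_jacobi_periodic[OF jac]
      by (metis vec_residue_in_box vec_residue_padic_vec_of_int)
    then show ?thesis
      using asymptotically_measure_preserving_iff[OF jac] bijective_mod_ge_iff[OF jac, of "?N + 1"]
      unfolding det by simp
  qed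
  \<comment> \<open>The second equivalence mentions no Jacobi matrix, so one has to be supplied; the
    second assumption provides it.\<close>
  then show ?thesis
    using assms(2) unfolding integer_valued_derivatives_mod_def by blast
qed

end
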